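(* For fixed boundary curvatures $\kappa_j,\kappa_{j+1}\in\mathbb{R}$ and edge length $h=e_j>0$, the non-Euclidean insertion angle $\alpha_j^{K}$ for constant curvature $K\neq 0$ and the Euclidean insertion angle $\alpha_j^{0}$ satisfy $$\left|\alpha_j^{K}-\alpha_j^{0}\right|\le C\,|K|\,h^3,$$ where $C=C(\kappa_j,\kappa_{j+1})$ is a bounded constant depending only on the boundary curvatures.
   Context: For $K\in\mathbb{R}$, edge length $e_j=h>0$ and boundary curvatures $\kappa_j,\kappa_{j+1}$, let $\kappa_g$ be the solution on $[0,e_j]$ of the boundary value problem $$\kappa_g''=K\kappa_g,\qquad \kappa_g(0)=\kappa_j,\quad \kappa_g(e_j)=\kappa_{j+1},$$ which is unique when $e_j$ is not a resonance length of the operator $\frac{d^2}{ds^2}-K$ (i.e. when the homogeneous Dirichlet problem on $[0,e_j]$ has only the zero solution; this is a standing assumption). The insertion angle is $$\alpha_j^{K}=\int_0^{e_j/2}\kappa_g(s)\,ds .$$ Explicitly, with $\ell=e_j/2$ and $c_1=\kappa_j$: - $K=0$: $\alpha_j^0=c_1\ell+\tfrac12 c_2\ell^2$ with $c_2=\dfrac{\kappa_{j+1}-\kappa_j}{e_j}$; - $K=+1$: $\alpha_j^{+1}=c_1\sinh\ell+c_2(\cosh\ell-1)$ with $c_2=\dfrac{\kappa_{j+1}-\kappa_j\cosh e_j}{\sinh e_j}$; - $K=-1$: $\alpha_j^{-1}=c_1\sin\ell-c_2(\cos\ell-1)$ with $c_2=\dfrac{\kappa_{j+1}-\kappa_j\cos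 e_j}{\sin e_j}$.
   Formalization: The edge length h is required to satisfy √|K|·|h−L| ≥ δ for every resonance length L, for a fixed δ > 0, and C may also depend on δ; without this the claim fails for K = −1, h → π. C is bounded on bounded sets of boundary curvatures. *)

theory Defs
  imports "HOL-Analysis.Analysis"
begin

text \<open>Derivatives are taken within the interval, hence one-sided at its end points.\<close>

definition curvature_ode :: "real \<Rightarrow> real \<Rightarrow> (real \<Rightarrow> real) \<Rightarrow> bool" where
  "curvature_ode K h f \<longleftrightarrow>
     (\<exists>f'. \<forall>s\<in>{0..h}. (f has_real_derivative f' s) (at s within {0..h}) \<and>
                     (f' has_real_derivative K * f s) (at s within {0..h}))"

definition curvature_bvp :: "real \<Rightarrow> real \<Rightarrow> real \<Rightarrow> real \<Rightarrow> (real \<Rightarrow> real) \<Rightarrow> bool" where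
  "curvature_bvp K h \<kappa>0 \<kappa>1 f \<longleftrightarrow> curvature_ode K h f \<and> f 0 = \<kappa>0 \<and> f h = \<kappa>1"

definition resonance_length :: "real \<Rightarrow> real \<Rightarrow> bool" where
  "resonance_length K L \<longleftrightarrow> 0 < L \<and> (\<exists>f. curvature_bvp K L 0 0 f \<and> (\<exists>s\<in>{0..L}. f s \<noteq> 0))"

text \<open>
  Quantitative form of non-resonance, invariant under rescaling of length. For \<open>\<delta> > 0\<close> and
  \<open>K \<noteq> 0\<close> it implies that \<open>h\<close> is not a resonance length; conversely every non-resonant \<open>h > 0\<close>
  satisfies it for some \<open>\<delta> > 0\<close>, since the resonance lengths are the numbers
  \<open>n * pi / sqrt (- K)\<close> with \<open>n \<ge> 1\<close> if \<open>K < 0\<close>, and there are none if \<open>K \<ge> 0\<close>.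
  A positive separation is needed for a uniform estimate: for \<open>K = -1\<close> and \<open>\<kappa>0 + \<kappa>1 \<noteq> 0\<close> the
  insertion angle is unbounded as \<open>h\<close> tends to \<open>pi\<close>.
\<close>

definition resonance_separated :: "real \<Rightarrow> real \<Rightarrow> real \<Rightarrow> bool" where
  "resonance_separated \<delta> K h \<longleftrightarrow>
     (\<forall>L. resonance_length K L \<longrightarrow> \<delta> \<le> sqrt \<bar>K\<bar> * \<bar>h - L\<bar>)"

text \<open>
  The solution is unique only on \<open>{0..h}\<close>, not as a function on the whole real line, so the
  description operator is applied to the angle rather than to the solution.
\<close>

definition insertion_angle :: "real \<Rightarrow> real \<Rightarrow> real \<Rightarrow> real \<Rightarrow> real" where
  "insertion_angle K h \<kappa>0 \<kappa>1 =
     (THE \<alpha>. \<exists>f. curvature_bvp K h \<kappa>0 \<kappa>1 f \<and> (f has_integral \<alpha>) {0..h/2})"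

end

theory Submission
  imports Defs
begin

text \<open>
  The difference \<open>g\<close> of the two solutions solves \<open>g'' = K * f\<close> with zero boundary values, where
  \<open>f\<close> is the solution for curvature \<open>K\<close>. If \<open>\<bar>f\<bar> \<le> M\<close>, then Rolle's theorem gives a zero of \<open>g'\<close>,
  so \<open>\<bar>g'\<bar> \<le> \<bar>K\<bar> * M * h\<close> and \<open>\<bar>g\<bar> \<le> \<bar>K\<bar> * M * h\<^sup>2\<close>, and integration over \<open>{0..h/2}\<close> gives the third power
  of \<open>h\<close>. A bound \<open>M\<close> depending only on \<open>\<delta>\<close> and the boundary values is read off the explicit
  solution; for \<open>K < 0\<close> its denominator \<open>sin (sqrt (- K) * h)\<close> is controlled by the distance of
  \<open>sqrt (- K) * h\<close> to the positive multiples of \<open>pi\<close>.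
\<close>

section \<open>Superposition and a priori bounds for the boundary value problem\<close>

lemma curvature_bvpI:
  assumes "\<And>s. (f has_real_derivative f' s) (at s)"
    and "\<And>s. (f' has_real_derivative K * f s) (at s)"
    and "f 0 = a" and "f h = b"
  shows "curvature_bvp K h a b f"
  using assms unfolding curvature_bvp_def curvature_ode_def
  by (auto intro!: exI[of _ f'] intro: has_field_derivative_at_within)

lemma curvature_bvp_diff:
  assumes "curvature_bvp K h a b f" "curvature_bvp K h a' b' g"
  shows "curvature_bvp K h (a - a') (b - b') (\<lambda>s. f s - g s)"
proof -
  obtain f' g' where
    "\<And>s. s \<in> {0..h} \<Longrightarrow> (f has_real_derivative f' s) (at s within {0..h})"
    "\<And>s. s \<in> {0..h} \<Longrightarrow> (f' has_real_derivative K * f s) (at s within {0..h})"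
    "\<And>s. s \<in> {0..h} \<Longrightarrow> (g has_real_derivative g' s) (at s within {0..h})"
    "\<And>s. s \<in> {0..h} \<Longrightarrow> (g' has_real_derivative K * g s) (at s within {0..h})"
    using assms unfolding curvature_bvp_def curvature_ode_def by metis
  then have "curvature_ode K h (\<lambda>s. f s - g s)"
    unfolding curvature_ode_def right_diff_distrib
    by (intro exI[of _ "\<lambda>s. f' s - g' s"] ballI conjI DERIV_diff)
  then show ?thesis
    using assms by (simp add: curvature_bvp_def)
qed

lemma curvature_bvp_continuous_on:
  assumes "curvature_bvp K h a b f"
  shows "continuous_on {0..h} f"
  using assms unfolding curvature_bvp_def curvature_ode_def
  by (meson DERIV_continuous_on)

text \<open>Two mean value estimates, starting from a zero of \<open>g'\<close> and from the zero of
  \<open>g\<close> at \<open>0\<close>, each contribute a factor \<open>h\<close>. Leaving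
  \<open>g''\<close> arbitrary lets the bound serve both uniqueness for \<open>K = 0\<close> and the
  comparison of solutions for different curvatures.\<close>

lemma dirichlet_second_derivative_bound:
  fixes g :: "real \<Rightarrow> real"
  assumes h: "0 < h"
    and g': "\<And>s. s \<in> {0..h} \<Longrightarrow> (g has_real_derivative g' s) (at s within {0..h})"
    and g'': "\<And>s. s \<in> {0..h} \<Longrightarrow> (g' has_real_derivative g'' s) (at s within {0..h})"
    and bound: "\<And>s. s \<in> {0..h} \<Longrightarrow> \<bar>g'' s\<bar> \<le> B"
    and zero: "g 0 = 0" "g h = 0"
    and s: "s \<in> {0..h}"
  shows "\<bar>g s\<bar> \<le> B * h\<^sup>2"
proof -
  have B: "0 \<le> B"
    using bound[OF s] by linarith
  obtain \<xi> where "\<xi> \<in> {0<..<h}" "g h - g 0 = g' \<xi> * (h - 0)"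
    using mvt_simple[OF h, of g "\<lambda>x y. g' x * y"] g' by (auto simp: has_field_derivative_def)
  then have \<xi>: "\<xi> \<in> {0..h}" "g' \<xi> = 0"
    using zero h by auto
  have g'_bound: "norm (g' t) \<le> B * h" if t: "t \<in> {0..h}" for t
  proof -
    have "norm (g' t - g' \<xi>) \<le> B * norm (t - \<xi>)"
      by (rule field_differentiable_bound[OF _ g'']) (use bound t \<xi> in auto)
    also have "\<dots> \<le> B * h"
      using t \<xi> B by (intro mult_left_mono) auto
    finally show ?thesis
      using \<xi> by simp
  qed
  have "norm (g s - g 0) \<le> (B * h) * norm (s - 0)"
    by (rule field_differentiable_bound[OF _ g' g'_bound]) (use s h in auto)
  also have "\<dots> \<le> (B * h) * h"
    using s h B by (intro mult_left_mono) auto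
  finally show ?thesis
    using zero by (simp add: power2_eq_square)
qed

section \<open>Non-resonance and the comparison of insertion angles\<close>

lemma not_resonance_length_0: "\<not> resonance_length 0 h"
proof
  assume "resonance_length 0 h"
  then obtain f f' s where h: "0 < h" and s: "s \<in> {0..h}" "f s \<noteq> 0" and "f 0 = 0" "f h = 0"
    and "\<And>s. s \<in> {0..h} \<Longrightarrow> (f has_real_derivative f' s) (at s within {0..h})"
    and "\<And>s. s \<in> {0..h} \<Longrightarrow> (f' has_real_derivative 0) (at s within {0..h})"
    unfolding resonance_length_def curvature_bvp_def curvature_ode_def mult_zero_left by metis
  \<comment> \<open>For \<open>K = 0\<close> the second derivative vanishes, so the bound holds with
    \<open>B = 0\<close>.\<close>
  then have "\<bar>f s\<bar> \<le> 0 * h\<^sup>2"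
    by (intro dirichlet_second_derivative_bound[where g' = f' and g'' = "\<lambda>_. 0"]) auto
  with s show False
    by simp
qed

lemma not_resonance_length_separated:
  assumes "0 < \<delta>" "resonance_separated \<delta> K h"
  shows "\<not> resonance_length K h"
  using assms unfolding resonance_separated_def by force

text \<open>Two solutions differ by a solution of the homogeneous Dirichlet problem, which vanishes
  on \<open>{0..h}\<close> by non-resonance. So the description operator has exactly one candidate,
  and any explicit solution computes the angle.\<close>

lemma insertion_angle_eq_integral:
  assumes h: "0 < h" and nr: "\<not> resonance_length K h" and f: "curvature_bvp K h a b f"
  shows "insertion_angle K h a b = integral {0..h/2} f"
  unfolding insertion_angle_def
proof (rule the_equality)
  have "continuous_on {0..h/2} f"
    by (rule continuous_on_subset[OF curvature_bvp_continuous_on[OF f]]) (use h in auto)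
  then show "\<exists>f'. curvature_bvp K h a b f' \<and> (f' has_integral integral {0..h/2} f) {0..h/2}"
    using f by (blast intro: integrable_integral integrable_continuous_interval)
next
  fix \<alpha> assume "\<exists>g. curvature_bvp K h a b g \<and> (g has_integral \<alpha>) {0..h/2}"
  then obtain g where g: "curvature_bvp K h a b g" and int: "(g has_integral \<alpha>) {0..h/2}"
    by blast
  have "f s = g s" if "s \<in> {0..h}" for s
    using curvature_bvp_diff[OF f g] nr h that unfolding resonance_length_def by force
  then have "integral {0..h/2} f = integral {0..h/2} g"
    using h by (intro integral_cong) auto
  with int show "\<alpha> = integral {0..h/2} f"
    by (simp add: integral_unique)
qed

text \<open>The pointwise bound of order \<open>h\<^sup>2\<close> on the difference of the solutions
  is integrated over an interval of length \<open>h/2\<close>, whence the factor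
  \<open>M / 2\<close>.\<close>

lemma insertion_angle_diff_bound:
  assumes h: "0 < h" and nr: "\<not> resonance_length K h" and f: "curvature_bvp K h a b f"
    and M: "\<And>s. s \<in> {0..h} \<Longrightarrow> \<bar>f s\<bar> \<le> M"
  shows "\<bar>insertion_angle K h a b - insertion_angle 0 h a b\<bar> \<le> M / 2 * \<bar>K\<bar> * h ^ 3"
proof -
  \<comment> \<open>The solution for \<open>K = 0\<close> is the linear interpolant. Being affine,
    it does not contribute to the second derivative of \<open>f - f0\<close>, which is therefore
    \<open>K * f\<close>.\<close>
  define f0 where "f0 = (\<lambda>s. a + (b - a) / h * s)"
  have f0: "curvature_bvp 0 h a b f0"
    by (rule curvature_bvpI[where f' = "\<lambda>_. (b - a) / h"])
       (use h in \<open>auto simp: f0_def intro!: derivative_eq_intros\<close>)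
  obtain f' where f': "\<And>s. s \<in> {0..h} \<Longrightarrow> (f has_real_derivative f' s) (at s within {0..h})"
    and f'': "\<And>s. s \<in> {0..h} \<Longrightarrow> (f' has_real_derivative K * f s) (at s within {0..h})"
    using f unfolding curvature_bvp_def curvature_ode_def by metis
  have diff: "\<bar>f s - f0 s\<bar> \<le> (\<bar>K\<bar> * M) * h\<^sup>2" if "s \<in> {0..h}" for s
  proof (rule dirichlet_second_derivative_bound[OF h _ _ _ _ _ that])
    fix t assume t: "t \<in> {0..h}"
    show "((\<lambda>s. f s - f0 s) has_real_derivative f' t - (b - a) / h) (at t within {0..h})"
      unfolding f0_def by (rule derivative_eq_intros f'[OF t] refl | simp)+
    show "((\<lambda>t. f' t - (b - a) / h) has_real_derivative K * f t) (at t within {0..h})"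
      by (rule derivative_eq_intros f''[OF t] refl | simp)+
    show "\<bar>K * f t\<bar> \<le> \<bar>K\<bar> * M"
      using M[OF t] by (simp add: abs_mult mult_left_mono)
  qed (use f f0 in \<open>auto simp: curvature_bvp_def\<close>)
  have sub: "{0..h/2} \<subseteq> {0..h}"
    using h by auto
  have cont: "continuous_on {0..h/2} f" "continuous_on {0..h/2} f0"
    using f f0 curvature_bvp_continuous_on continuous_on_subset sub by blast+
  have "insertion_angle K h a b - insertion_angle 0 h a b
      = integral {0..h/2} (\<lambda>s. f s - f0 s)"
    by (simp add: insertion_angle_eq_integral[OF h nr f] integral_diff cont
        insertion_angle_eq_integral[OF h not_resonance_length_0 f0] integrable_continuous_interval)
  also have "norm \<dots> \<le> (\<bar>K\<bar> * M) * h\<^sup>2 * (h/2 - 0)"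
    by (rule integral_bound)
       (use h diff sub in \<open>auto intro!: continuous_intros cont\<close>)
  finally show ?thesis
    by (simp add: power2_eq_square power3_eq_cube mult_ac)
qed

section \<open>Bounded explicit solutions for positive curvature\<close>

lemma abs_weighted_sum_le:
  fixes a b p q m :: real
  assumes "\<bar>p\<bar> \<le> m" "\<bar>q\<bar> \<le> m"
  shows "\<bar>a * p + b * q\<bar> \<le> (\<bar>a\<bar> + \<bar>b\<bar>) * m"
proof -
  have "\<bar>a * p + b * q\<bar> \<le> \<bar>a\<bar> * \<bar>p\<bar> + \<bar>b\<bar> * \<bar>q\<bar>"
    by (metis abs_mult abs_triangle_ineq)
  also have "\<dots> \<le> (\<bar>a\<bar> + \<bar>b\<bar>) * m"
    using assms by (auto simp: distrib_right intro!: add_mono mult_left_mono)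
  finally show ?thesis .
qed

text \<open>The solution is the combination of the two basis solutions with boundary values
  \<open>1, 0\<close> and \<open>0, 1\<close>. Both take values in the unit interval because
  \<open>sinh\<close> is increasing.\<close>

lemma curvature_bvp_bounded_solution_pos:
  assumes K: "0 < K" and h: "0 < h"
  shows "\<exists>f. curvature_bvp K h a b f \<and> (\<forall>s\<in>{0..h}. \<bar>f s\<bar> \<le> \<bar>a\<bar> + \<bar>b\<bar>)"
proof -
  define k where "k = sqrt K"
  have k: "0 < k" "k * k = K"
    using K by (auto simp: k_def)
  define D where "D = sinh (k * h)"
  have D: "0 < D"
    using k h by (simp add: D_def)
  define f where "f = (\<lambda>s. a * (sinh (k * (h - s)) / D) + b * (sinh (k * s) / D))"
  define f' where "f' = (\<lambda>s. a * (- k * cosh (k * (h - s)) / D) + b * (k * cosh (k * s) / D))"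
  have "curvature_bvp K h a b f"
  proof (rule curvature_bvpI)
    show "(f has_real_derivative f' s) (at s)" for s
      unfolding f_def f'_def by (rule derivative_eq_intros refl | use D in \<open>simp add: field_simps\<close>)+
    show "(f' has_real_derivative K * f s) (at s)" for s
      unfolding f_def f'_def k(2)[symmetric]
      by (rule derivative_eq_intros refl | use D in \<open>simp add: field_simps\<close>)+
  qed (use D k h in \<open>simp_all add: f_def D_def\<close>)
  moreover have "\<bar>f s\<bar> \<le> \<bar>a\<bar> + \<bar>b\<bar>" if "s \<in> {0..h}" for s
  proof -
    have "\<bar>sinh (k * t) / D\<bar> \<le> 1" if "t \<in> {0..h}" for t
      using that k D by (simp add: D_def)
    from abs_weighted_sum_le[OF this this] that show ?thesis
      unfolding f_def by fastforce
  qed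
  ultimately show ?thesis
    by blast
qed

section \<open>Negative curvature: resonance lengths and small denominators\<close>

lemma resonance_length_neg:
  assumes "K < 0" "0 < n"
  shows "resonance_length K (real n * pi / sqrt (- K))"
proof -
  define k where "k = sqrt (- K)"
  have k: "0 < k" "k * k = - K"
    using assms by (auto simp: k_def)
  define L where "L = real n * pi / k"
  have "curvature_bvp K L 0 0 (\<lambda>s. sin (k * s))"
  proof (rule curvature_bvpI)
    show "((\<lambda>s. sin (k * s)) has_real_derivative k * cos (k * s)) (at s)" for s
      by (rule derivative_eq_intros refl | simp)+
    have K: "K = - (k * k)"
      using k by simp
    show "((\<lambda>s. k * cos (k * s)) has_real_derivative K * sin (k * s)) (at s)" for s
      unfolding K by (rule derivative_eq_intros refl | simp)+
  qed (use k in \<open>simp_all add: L_def\<close>)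
  \<comment> \<open>The first maximum of the sine witnesses that the solution is nonzero; it lies in
    the interval since \<open>n \<ge> 1\<close>.\<close>
  moreover have "pi / (2 * k) \<in> {0..L}" "sin (k * (pi / (2 * k))) \<noteq> 0"
    using assms k by (auto simp: L_def field_simps)
  moreover have "0 < L"
    using assms k by (simp add: L_def)
  ultimately show ?thesis
    unfolding resonance_length_def L_def k_def by blast
qed

text \<open>Subtracting the nearest multiple of \<open>pi\<close> preserves the modulus of the sine
  and leads to \<open>\<bar>y\<bar> \<le> pi / 2\<close>, where that modulus increases with
  \<open>\<bar>y\<bar>\<close>.\<close>

lemma abs_sin_ge_away_from_multiples:
  assumes x: "pi / 2 \<le> x" and \<mu>: "0 \<le> \<mu>" "\<mu> \<le> pi / 2"
    and sep: "\<And>n::nat. 0 < n \<Longrightarrow> \<mu> \<le> \<bar>x - real n * pi\<bar>"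
  shows "sin \<mu> \<le> \<bar>sin x\<bar>"
proof -
  define r where "r = round (x / pi)"
  \<comment> \<open>As \<open>round\<close> rounds halves up, this already makes the nearest
    multiple positive, as \<open>sep\<close> requires.\<close>
  have "1 / 2 \<le> x / pi"
    using x by (simp add: field_simps)
  then have r: "0 < r"
    unfolding r_def round_def by linarith
  define y where "y = x - of_int r * pi"
  have "\<bar>of_int r - x / pi\<bar> \<le> 1 / 2"
    unfolding r_def by (rule of_int_round_abs_le)
  then have "\<bar>of_int r - x / pi\<bar> * pi \<le> 1 / 2 * pi"
    by (intro mult_right_mono) auto
  also have "\<bar>of_int r - x / pi\<bar> * pi = \<bar>(of_int r - x / pi) * pi\<bar>"
    by (simp add: abs_mult)
  also have "(of_int r - x / pi) * pi = - y"
    by (simp add: y_def field_simps)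
  finally have y: "\<bar>y\<bar> \<le> pi / 2"
    by simp
  have "\<mu> \<le> \<bar>y\<bar>"
    using sep[of "nat r"] r by (simp add: y_def)
  then have "sin \<mu> \<le> sin \<bar>y\<bar>"
    using y \<mu> by (intro sin_monotone_2pi_le) auto
  also have "\<dots> = \<bar>sin y\<bar>"
    using y sin_ge_zero[of y] sin_ge_zero[of "- y"] by (cases "0 \<le> y") auto
  also have "\<bar>sin y\<bar> = \<bar>sin x\<bar>"
    by (simp add: y_def sin_diff sin_int_times_real abs_mult cos_int_times_real
        mult.commute[of _ pi])
  finally show ?thesis .
qed

text \<open>The denominator \<open>sin (k * h)\<close> can be small for two reasons. Near
  \<open>0\<close> the numerators are no larger, so the quotients stay bounded; near a positive
  multiple of \<open>pi\<close> the separation from resonance bounds the denominator from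
  below.\<close>

lemma curvature_bvp_bounded_solution_neg:
  assumes K: "K < 0" and h: "0 < h" and \<delta>: "0 < \<delta>" and sep: "resonance_separated \<delta> K h"
  shows "\<exists>f. curvature_bvp K h a b f \<and>
    (\<forall>s\<in>{0..h}. \<bar>f s\<bar> \<le> (\<bar>a\<bar> + \<bar>b\<bar>) * (1 / sin (min \<delta> (pi / 2))))"
proof -
  define k where "k = sqrt (- K)"
  have k: "0 < k" "K = - (k * k)"
    using K by (auto simp: k_def)
  \<comment> \<open>Capping \<open>\<delta>\<close> at \<open>pi / 2\<close> keeps the argument in
    the range where the sine is positive and increasing.\<close>
  define m where "m = sin (min \<delta> (pi / 2))"
  have m: "0 < m" "m \<le> 1"
    using \<delta> by (auto simp: m_def min_less_iff_disj intro!: sin_gt_zero)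
  define D where "D = sin (k * h)"
  have sin_le: "D \<noteq> 0 \<and> (\<forall>t\<in>{0..h}. \<bar>sin (k * t) / D\<bar> \<le> 1 / m)"
  proof (cases "k * h < pi / 2")
    case True
    then have D: "0 < D"
      using k h pi_gt_zero unfolding D_def by (intro sin_gt_zero mult_pos_pos) linarith+
    have "\<bar>sin (k * t) / D\<bar> \<le> 1 / m" if "t \<in> {0..h}" for t
    proof -
      have t: "0 \<le> k * t" "k * t \<le> k * h"
        using that k by auto
      then have "sin (k * t) \<le> D"
        unfolding D_def using True by (intro sin_monotone_2pi_le) linarith+
      moreover have "0 \<le> sin (k * t)"
        using t True pi_gt_zero by (intro sin_ge_zero) linarith+
      ultimately have "\<bar>sin (k * t) / D\<bar> \<le> 1"
        using D by simp
      also have "1 \<le> 1 / m"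
        using m by simp
      finally show ?thesis .
    qed
    then show ?thesis
      using D by blast
  next
    case False
    \<comment> \<open>Multiplying lengths by \<open>k\<close> turns the resonance lengths into
      multiples of \<open>pi\<close>.\<close>
    have "\<delta> \<le> \<bar>k * h - real n * pi\<bar>" if "0 < n" for n
    proof -
      have "\<delta> \<le> k * \<bar>h - real n * pi / k\<bar>"
        using sep resonance_length_neg[OF K that] K
        unfolding resonance_separated_def k_def by simp
      also have "\<dots> = \<bar>k * (h - real n * pi / k)\<bar>"
        using k by (simp add: abs_mult)
      finally show ?thesis
        using k by (simp add: right_diff_distrib)
    qed
    then have mD: "m \<le> \<bar>D\<bar>"
      unfolding m_def D_def using False \<delta>
      by (intro abs_sin_ge_away_from_multiples) (auto simp: min.coboundedI1)
    have "\<bar>sin (k * t) / D\<bar> \<le> 1 / m" for t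
      using mD m by (auto simp: abs_divide intro!: frac_le)
    then show ?thesis
      using mD m by auto
  qed
  then have D: "D \<noteq> 0"
    by blast
  define f where "f = (\<lambda>s. a * (sin (k * (h - s)) / D) + b * (sin (k * s) / D))"
  define f' where "f' = (\<lambda>s. a * (- k * cos (k * (h - s)) / D) + b * (k * cos (k * s) / D))"
  have "curvature_bvp K h a b f"
  proof (rule curvature_bvpI)
    show "(f has_real_derivative f' s) (at s)" for s
      unfolding f_def f'_def by (rule derivative_eq_intros refl | use D in \<open>simp add: field_simps\<close>)+
    show "(f' has_real_derivative K * f s) (at s)" for s
      unfolding f_def f'_def k(2)
      by (rule derivative_eq_intros refl | use D in \<open>simp add: field_simps\<close>)+
  qed (use D in \<open>simp_all add: f_def D_def\<close>)
  moreover have "\<bar>f s\<bar> \<le> (\<bar>a\<bar> + \<bar>b\<bar>) * (1 / m)" if "s \<in> {0..h}" for s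
    unfolding f_def by (rule abs_weighted_sum_le) (use sin_le that in auto)
  ultimately show ?thesis
    unfolding m_def by blast
qed

section \<open>The uniform constant\<close>

theorem lemma1:
  fixes \<delta> :: real
  assumes "0 < \<delta>"
  shows "\<exists>C :: real \<Rightarrow> real \<Rightarrow> real.
           (\<forall>S. bounded S \<longrightarrow> bounded (case_prod C ` S)) \<and>
           (\<forall>\<kappa>0 \<kappa>1 K h. K \<noteq> 0 \<longrightarrow> 0 < h \<longrightarrow> resonance_separated \<delta> K h \<longrightarrow>
              \<bar>insertion_angle K h \<kappa>0 \<kappa>1 - insertion_angle 0 h \<kappa>0 \<kappa>1\<bar> \<le> C \<kappa>0 \<kappa>1 * \<bar>K\<bar> * h ^ 3)"
proof -
  define c where "c = 1 / sin (min \<delta> (pi / 2))"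
  have "0 < sin (min \<delta> (pi / 2))"
    using assms by (auto simp: min_less_iff_disj intro!: sin_gt_zero)
  \<comment> \<open>This lets the one constant \<open>c\<close> also cover \<open>K > 0\<close>,
    where the bound on the solution has factor \<open>1\<close>.\<close>
  then have c: "1 \<le> c"
    by (simp add: c_def)
  define C where "C = (\<lambda>a b. (\<bar>a\<bar> + \<bar>b\<bar>) * c / 2)"
  show ?thesis
  proof (intro exI[of _ C] conjI allI impI)
    fix S :: "(real \<times> real) set" assume "bounded S"
    then obtain B where B: "\<And>p. p \<in> S \<Longrightarrow> norm p \<le> B"
      by (auto simp: bounded_iff)
    have "norm (C a b) \<le> (B + B) * c / 2" if "(a, b) \<in> S" for a b
    proof -
      have "\<bar>a\<bar> \<le> B" "\<bar>b\<bar> \<le> B"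
        using B[OF that] norm_fst_le[of a b] norm_snd_le[of b a] by auto
      then show ?thesis
        using c by (auto simp: C_def abs_mult intro!: mult_right_mono)
    qed
    then show "bounded (case_prod C ` S)"
      unfolding bounded_iff by fast
  next
    fix a b K h :: real
    assume K: "K \<noteq> 0" and h: "0 < h" and sep: "resonance_separated \<delta> K h"
    have "\<exists>f. curvature_bvp K h a b f \<and> (\<forall>s\<in>{0..h}. \<bar>f s\<bar> \<le> (\<bar>a\<bar> + \<bar>b\<bar>) * c)"
    proof (cases "0 < K")
      case True
      have "(\<bar>a\<bar> + \<bar>b\<bar>) * 1 \<le> (\<bar>a\<bar> + \<bar>b\<bar>) * c"
        using c by (intro mult_left_mono) auto
      with curvature_bvp_bounded_solution_pos[OF True h, of a b] show ?thesis
        by fastforce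
    next
      case False
      with K curvature_bvp_bounded_solution_neg[OF _ h assms sep] show ?thesis
        unfolding c_def by simp
    qed
    then obtain f where "curvature_bvp K h a b f" "\<And>s. s \<in> {0..h} \<Longrightarrow> \<bar>f s\<bar> \<le> (\<bar>a\<bar> + \<bar>b\<bar>) * c"
      by blast
    from insertion_angle_diff_bound[OF h not_resonance_length_separated[OF assms sep] this]
    show "\<bar>insertion_angle K h a b - insertion_angle 0 h a b\<bar> \<le> C a b * \<bar>K\<bar> * h ^ 3"
      by (simp add: C_def)
  qed
qed

end
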